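(* Let $N>0$, $p>0$ and $x\ne 0$ be real numbers and put $M=N^4+x$. Suppose that $M$ differs from $N^4$ by less than $p\%$ of either, i.e. $|x|<\frac{p}{100}N^4$ and $|x|<\frac{p}{100}M$. Let $$S:=\frac{51}{56}N+\frac{5}{56}\frac{M}{N^3}+\frac{27Nx}{14(7M+5N^4)}.$$ If $x$ is negative, then $$\left|\sqrt[4]{M}-S\right|<\frac{77}{2048}\left\{\left(1+\frac{p}{100}\right)^{\frac{15}{4}}-\frac{28}{33}\right\}\left(\frac{p}{100+p}\right)^4 N,$$ and if $x$ is positive, then $$\left|\sqrt[4]{M}-S\right|<\frac{77}{2048}\left\{1-\frac{28}{33}\,\frac{1}{1+\frac{7}{12}\frac{p}{100}}\right\}\left(\frac{p}{100}\right)^4 N.$$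
   Context: $\sqrt[4]{M}$ denotes the nonnegative real fourth root of $M$ (the hypotheses force $M>0$). *)

theory Defs
  imports Complex_Main
begin

end

theory Submission
  imports Defs
begin

text \<open>
  Dividing by \<open>N\<close> and putting \<open>t = x / N^4\<close>, \<open>S / N\<close> is the cubic Taylor polynomial of
  \<open>(1 + t) powr (1/4)\<close> at \<open>0\<close> minus \<open>77/2048 * t^4 * (28/33) / (1 + 7 * t / 12)\<close>. With the Lagrange
  remainder of the fourth root, the error is \<open>77/2048 * t^4\<close> times a bracket that monotonicity
  bounds from above. An upper bound suffices because \<open>S\<close> never underestimates the root: in terms of
  \<open>y = (1 + t) powr (1/4)\<close> the error is \<open>(y - 1)^4\<close> times a quotient of polynomials with positive
  coefficients.
\<close>

definition fourth_root_approx :: "real \<Rightarrow> real" where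
  "fourth_root_approx t = 51 / 56 + 5 / 56 * (1 + t) + 27 * t / (14 * (12 + 7 * t))"

lemma fourth_root_approx_scale:
  fixes N x :: real
  assumes "N > 0"
  shows "51 / 56 * N + 5 / 56 * ((N ^ 4 + x) / N ^ 3) + 27 * N * x / (14 * (7 * (N ^ 4 + x) + 5 * N ^ 4))
    = N * fourth_root_approx (x / N ^ 4)"
proof -
  define t where "t = x / N ^ 4"
  have x: "x = t * N ^ 4" using assms by (simp add: t_def)
  have A: "(N ^ 4 + x) / N ^ 3 = N * (1 + t)"
    using assms by (simp add: x field_simps power_numeral_reduce)
  have "27 * N * x / (14 * (7 * (N ^ 4 + x) + 5 * N ^ 4))
      = (N ^ 4 * (N * (27 * t))) / (N ^ 4 * (14 * (12 + 7 * t)))"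
    by (simp add: x algebra_simps)
  also have "\<dots> = N * (27 * t / (14 * (12 + 7 * t)))"
    using assms by (subst mult_divide_mult_cancel_left) auto
  finally show ?thesis
    unfolding A t_def [symmetric] by (simp add: fourth_root_approx_def algebra_simps)
qed

text \<open>Both sides have the same cubic Taylor polynomial at \<open>t = 0\<close>, so their
  difference vanishes to fourth order there; hence the factor \<open>(y - 1) ^ 4\<close>.\<close>

lemma fourth_root_le_approx:
  fixes t :: real
  assumes "t > -1"
  shows "root 4 (1 + t) \<le> fourth_root_approx t"
proof -
  define y where "y = root 4 (1 + t)"
  have y: "y > 0" and t: "t = y ^ 4 - 1"
    using assms by (auto simp: y_def)
  have D: "5 + 7 * y ^ 4 > 0" using y by (simp add: add_pos_pos)
  have "fourth_root_approx t - y
      = (y - 1) ^ 4 * (5 * y ^ 4 + 20 * y ^ 3 + 50 * y\<^sup>2 + 44 * y + 21) / (8 * (5 + 7 * y ^ 4))"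
    (is "?e = ?n / _")
  proof -
    \<comment> \<open>Since \<open>12 + 7 * t = 5 + 7 * y ^ 4\<close>, the fraction \<open>r\<close>
      is tied down by one polynomial relation, which leaves a polynomial identity for
      \<open>algebra\<close>.\<close>
    define r where "r = 27 * t / (14 * (12 + 7 * t))"
    have "r * (5 + 7 * y ^ 4) = 27 / 14 * (y ^ 4 - 1)"
      using D by (simp add: r_def t divide_simps)
    moreover have "fourth_root_approx t = 51 / 56 + 5 / 56 * (1 + t) + r"
      by (simp add: fourth_root_approx_def r_def)
    ultimately have "?e * (8 * (5 + 7 * y ^ 4)) = ?n"
      using t by algebra
    then show ?thesis using D by (simp add: eq_divide_eq)
  qed
  also have "\<dots> \<ge> 0" using y D by simp
  finally show ?thesis by (simp add: y_def)
qed

lemma fourth_root_Taylor: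
  fixes t :: real
  assumes "t > -1" "t \<noteq> 0"
  obtains z where "if t < 0 then 1 + t < z \<and> z < 1 else 1 < z \<and> z < 1 + t"
    and "root 4 (1 + t) = 1 + t / 4 - 3 / 32 * t ^ 2 + 7 / 128 * t ^ 3
           - 77 / 2048 * t ^ 4 * z powr (- 15 / 4)"
proof -
  \<comment> \<open>For \<open>u > 0\<close>, \<open>d m\<close> is the \<open>m\<close>-th
    derivative of \<open>u powr (1 / 4)\<close>; the product is a falling factorial of
    \<open>1 / 4\<close>.\<close>
  define d :: "nat \<Rightarrow> real \<Rightarrow> real"
    where "d m u = (\<Prod>i<m. 1 / 4 - real i) * u powr (1 / 4 - real m)" for m u
  \<comment> \<open>This interval joins \<open>1\<close> and \<open>1 + t\<close> for either sign of
    \<open>t\<close>, and \<open>t > -1\<close> keeps it inside the positive reals.\<close>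
  let ?a = "min 1 (1 + t)" and ?b = "max 1 (1 + t)"
  have "\<exists>z. (if 1 + t < 1 then 1 + t < z \<and> z < 1 else 1 < z \<and> z < 1 + t) \<and>
      d 0 (1 + t) = (\<Sum>m<4. d m 1 / fact m * (1 + t - 1) ^ m) + d 4 z / fact 4 * (1 + t - 1) ^ 4"
  proof (rule Taylor [where a = ?a and b = ?b])
    show "\<forall>m u. m < 4 \<and> ?a \<le> u \<and> u \<le> ?b \<longrightarrow> DERIV (d m) u :> d (Suc m) u"
    proof (intro allI impI)
      fix m u assume "m < (4::nat) \<and> ?a \<le> u \<and> u \<le> ?b"
      with assms have "u > 0" by auto
      then show "DERIV (d m) u :> d (Suc m) u"
        unfolding d_def by (auto intro!: derivative_eq_intros simp: algebra_simps)
    qed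
  qed (use assms in auto)
  then obtain z where z: "if t < 0 then 1 + t < z \<and> z < 1 else 1 < z \<and> z < 1 + t"
    and eq: "d 0 (1 + t) = (\<Sum>m<4. d m 1 / fact m * t ^ m) + d 4 z / fact 4 * t ^ 4"
    by auto
  have "root 4 (1 + t) = d 0 (1 + t)"
    using assms by (simp add: d_def root_powr_inverse)
  \<comment> \<open>The last coefficient is
    \<open>(1/4) * (-3/4) * (-7/4) * (-11/4) / 24 = -77/2048\<close>, and the exponent is
    \<open>1/4 - 4\<close>.\<close>
  also have "\<dots> = 1 + t / 4 - 3 / 32 * t ^ 2 + 7 / 128 * t ^ 3 - 77 / 2048 * t ^ 4 * z powr (- 15 / 4)"
    by (subst eq) (simp add: d_def eval_nat_numeral)
  finally show ?thesis using z that by blast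
qed

text \<open>The cubic parts of root and approximation cancel, and
  \<open>fourth_root_le_approx\<close> opens the absolute value as approximation minus root. Only
  the position of \<open>z\<close> remains unknown.\<close>

lemma fourth_root_approx_error:
  fixes t :: real
  assumes "t > -1" "t \<noteq> 0"
  obtains z where "if t < 0 then 1 + t < z \<and> z < 1 else 1 < z \<and> z < 1 + t"
    and "\<bar>root 4 (1 + t) - fourth_root_approx t\<bar>
           = 77 / 2048 * (z powr (- 15 / 4) - 28 / 33 * (1 / (1 + 7 / 12 * t))) * t ^ 4"
proof -
  obtain z where z: "if t < 0 then 1 + t < z \<and> z < 1 else 1 < z \<and> z < 1 + t"
    and eq: "root 4 (1 + t) = 1 + t / 4 - 3 / 32 * t ^ 2 + 7 / 128 * t ^ 3
           - 77 / 2048 * t ^ 4 * z powr (- 15 / 4)"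
    using fourth_root_Taylor [OF assms] .
  have D: "12 + 7 * t > 0" using assms by simp
  define k where "k = 28 / 33 * (1 / (1 + 7 / 12 * t))"
  have "fourth_root_approx t = 1 + t / 4 - 3 / 32 * t ^ 2 + 7 / 128 * t ^ 3
      - 77 / 2048 * t ^ 4 * k"
  proof -
    define r where "r = 1 / (12 + 7 * t)"
    have r: "r * (12 + 7 * t) = 1" using D by (simp add: r_def)
    have "1 / (1 + 7 / 12 * t) = 12 * r" "27 * t / (14 * (12 + 7 * t)) = 27 / 14 * t * r"
      using D by (auto simp: r_def divide_simps)
    then show ?thesis
      using r unfolding fourth_root_approx_def k_def by algebra
  qed
  with eq have "\<bar>root 4 (1 + t) - fourth_root_approx t\<bar>
      = 77 / 2048 * (z powr (- 15 / 4) - k) * t ^ 4"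
    using fourth_root_le_approx [OF assms(1)] by (simp add: algebra_simps)
  with z that show ?thesis unfolding k_def by blast
qed

text \<open>Positivity is asked of the bound \<open>b\<close>, not of \<open>a\<close>: the error
  bracket can then be estimated without first finding its sign.\<close>

lemma mult_strict_mono_pos_right:
  fixes a b c d :: "'a :: linordered_semiring_strict"
  assumes "a < b" "c < d" "0 < b" "0 < c"
  shows "a * c < b * d"
  using mult_strict_right_mono [OF assms(1,4)] mult_strict_left_mono [OF assms(2,3)]
  by (rule less_trans)

text \<open>Here \<open>z\<close> lies above \<open>1 + t\<close>, which the bound relative to
  \<open>1 + t\<close> keeps away from zero; the subtracted fraction is smallest in the limit
  \<open>t = 0\<close>.\<close>

lemma fourth_root_approx_error_neg:
  fixes t q :: real
  assumes "t < 0" "q > 0" "- t < q * (1 + t)"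
  shows "\<bar>root 4 (1 + t) - fourth_root_approx t\<bar>
    < 77 / 2048 * ((1 + q) powr (15 / 4) - 28 / 33) * (q / (1 + q)) ^ 4"
proof -
  have "0 < q * (1 + t)" using assms by linarith
  then have t: "t > -1" using assms by (simp add: zero_less_mult_iff)
  obtain z where "if t < 0 then 1 + t < z \<and> z < 1 else 1 < z \<and> z < 1 + t"
    and eq: "\<bar>root 4 (1 + t) - fourth_root_approx t\<bar>
           = 77 / 2048 * (z powr (- 15 / 4) - 28 / 33 * (1 / (1 + 7 / 12 * t))) * t ^ 4"
    using fourth_root_approx_error [OF t less_imp_neq [OF assms(1)]] .
  with assms(1) have z: "1 + t < z" by simp
  \<comment> \<open>Both are the hypothesis \<open>- t < q * (1 + t)\<close> solved for
    \<open>t\<close>.\<close>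
  have lt: "1 / (1 + q) < 1 + t" "- t < q / (1 + q)"
    using assms by (auto simp: field_simps)
  have "z powr (- 15 / 4) < (1 / (1 + q)) powr (- 15 / 4)"
    using lt z assms by (intro powr_less_mono2_neg) auto
  also have "\<dots> = (1 + q) powr (15 / 4)"
    using assms by (simp add: powr_divide powr_minus_divide)
  finally have "z powr (- 15 / 4) < (1 + q) powr (15 / 4)" .
  moreover have "1 < 1 / (1 + 7 / 12 * t)" using t assms by simp
  ultimately have B: "z powr (- 15 / 4) - 28 / 33 * (1 / (1 + 7 / 12 * t))
      < (1 + q) powr (15 / 4) - 28 / 33" by linarith
  \<comment> \<open>With \<open>28 / 33 < 1\<close> this makes the bounding bracket
    positive.\<close>
  have "(1 + q) powr (15 / 4) \<ge> 1" using assms by (intro ge_one_powr_ge_zero) auto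
  moreover have "t ^ 4 < (q / (1 + q)) ^ 4"
    using power_strict_mono [of "- t" "q / (1 + q)" 4] lt assms by simp
  ultimately show ?thesis
    unfolding eq using B assms by - (rule mult_strict_mono_pos_right, auto)
qed

text \<open>Now \<open>z > 1\<close> bounds the power by \<open>1\<close>, while the subtracted
  fraction decreases in \<open>t\<close> and so exceeds its value at \<open>q\<close>.\<close>

lemma fourth_root_approx_error_pos:
  fixes t q :: real
  assumes "t > 0" "t < q"
  shows "\<bar>root 4 (1 + t) - fourth_root_approx t\<bar>
    < 77 / 2048 * (1 - 28 / 33 * (1 / (1 + 7 / 12 * q))) * q ^ 4"
proof -
  have t: "t > -1" "t \<noteq> 0" using assms by auto
  obtain z where "if t < 0 then 1 + t < z \<and> z < 1 else 1 < z \<and> z < 1 + t"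
    and eq: "\<bar>root 4 (1 + t) - fourth_root_approx t\<bar>
           = 77 / 2048 * (z powr (- 15 / 4) - 28 / 33 * (1 / (1 + 7 / 12 * t))) * t ^ 4"
    using fourth_root_approx_error [OF t] .
  with assms(1) have z: "1 < z" by simp
  have "z powr (- 15 / 4) < 1"
    using powr_less_mono2_neg [of "- 15 / 4" 1 z] z by simp
  moreover have "1 / (1 + 7 / 12 * q) < 1 / (1 + 7 / 12 * t)"
    using assms by (intro divide_strict_left_mono) auto
  ultimately have B: "z powr (- 15 / 4) - 28 / 33 * (1 / (1 + 7 / 12 * t))
      < 1 - 28 / 33 * (1 / (1 + 7 / 12 * q))" by linarith
  have "1 / (1 + 7 / 12 * q) < 1" using assms by simp
  then have C: "0 < 1 - 28 / 33 * (1 / (1 + 7 / 12 * q))" by linarith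
  have "t ^ 4 < q ^ 4"
    using assms by (intro power_strict_mono) auto
  then show ?thesis
    unfolding eq using assms mult_strict_left_mono [OF B, of "77 / 2048"] mult_pos_pos [OF _ C, of "77 / 2048"]
    by (intro mult_strict_mono_pos_right [of "77 / 2048 * _"]) (assumption | simp)+
qed

theorem theorem2p2:
  fixes N p x M S :: real
  assumes "N > 0" and "p > 0" and "x \<noteq> 0"
    and M_eq: "M = N ^ 4 + x"
    and "\<bar>x\<bar> < p / 100 * N ^ 4"
    and "\<bar>x\<bar> < p / 100 * M"
    and S_eq: "S = 51 / 56 * N + 5 / 56 * (M / N ^ 3) + 27 * N * x / (14 * (7 * M + 5 * N ^ 4))"
  shows "(x < 0 \<longrightarrow>
            \<bar>root 4 M - S\<bar>
              < 77 / 2048 * ((1 + p / 100) powr (15 / 4) - 28 / 33) * (p / (100 + p)) ^ 4 * N)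
       \<and> (x > 0 \<longrightarrow>
            \<bar>root 4 M - S\<bar>
              < 77 / 2048 * (1 - 28 / 33 * (1 / (1 + 7 / 12 * (p / 100)))) * (p / 100) ^ 4 * N)"
proof -
  define t where "t = x / N ^ 4"
  define q where "q = p / 100"
  have N4: "N ^ 4 > 0" and q: "q > 0" using assms by (auto simp: q_def)
  have x: "x = t * N ^ 4" using \<open>N > 0\<close> by (simp add: t_def)
  have M: "M = N ^ 4 * (1 + t)" by (simp add: M_eq x algebra_simps)
  have "root 4 M = N * root 4 (1 + t)"
    using \<open>N > 0\<close> by (simp add: M real_root_mult real_root_power_cancel)
  moreover have "S = N * fourth_root_approx t"
    unfolding S_eq M_eq t_def by (rule fourth_root_approx_scale [OF \<open>N > 0\<close>])
  ultimately have err: "\<bar>root 4 M - S\<bar> = \<bar>root 4 (1 + t) - fourth_root_approx t\<bar> * N"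
    using \<open>N > 0\<close> by (simp add: right_diff_distrib [symmetric] abs_mult)
  have pq: "p / (100 + p) = q / (1 + q)" using \<open>p > 0\<close> by (simp add: q_def field_simps)
  have "\<bar>t\<bar> * N ^ 4 < q * N ^ 4"
    using assms(5) N4 by (simp add: x q_def abs_mult)
  then have tq: "\<bar>t\<bar> < q" using N4 by simp
  \<comment> \<open>The factor \<open>1 + t\<close> is \<open>M / N ^ 4\<close>; for negative
    \<open>x\<close> it is below \<open>1\<close>, so this bound is sharper than
    \<open>tq\<close>.\<close>
  have "\<bar>t\<bar> * N ^ 4 < q * (1 + t) * N ^ 4"
    using assms(6) N4 by (simp add: M x q_def abs_mult mult_ac)
  then have tqM: "\<bar>t\<bar> < q * (1 + t)" using N4 by simp
  show ?thesis
    unfolding err pq q_def [symmetric]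
  proof (intro conjI impI mult_strict_right_mono [OF _ \<open>N > 0\<close>])
    assume "x < 0"
    then have "t < 0" using N4 by (simp add: t_def divide_neg_pos)
    then show "\<bar>root 4 (1 + t) - fourth_root_approx t\<bar>
        < 77 / 2048 * ((1 + q) powr (15 / 4) - 28 / 33) * (q / (1 + q)) ^ 4"
      using fourth_root_approx_error_neg q tqM by simp
  next
    assume "x > 0"
    then have "t > 0" using N4 by (simp add: t_def)
    then show "\<bar>root 4 (1 + t) - fourth_root_approx t\<bar>
        < 77 / 2048 * (1 - 28 / 33 * (1 / (1 + 7 / 12 * q))) * q ^ 4"
      using fourth_root_approx_error_pos tq by simp
  qed
qed

end
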